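(* Let $(\Omega,\mathcal{F})$ be a measurable space, let $\mathcal{X}$ be the set of bounded $\mathcal{F}$-measurable functions $\Omega\to\mathbb{R}$, let $\mathcal{E}:\mathcal{X}\to\mathbb{R}$ be a sublinear expectation, and let $\{\xi_n\}_{n\ge 1}\subset\mathcal{X}$ be a sequence that is pairwise uncorrelated with respect to $\mathcal{E}$. If $$\sup_{n\ge 1}\Big(\mathcal{E}\big[(\xi_n-\mathcal{E}(\xi_n))^2\big]+\big[\mathcal{E}(\xi_n)+\mathcal{E}(-\xi_n)\big]^2\Big)<\infty,$$ then there exist constants $\{\lambda_i\}_{i\ge 1}$ such that $\lambda_i\in[-\mathcal{E}(-\xi_i),\mathcal{E}(\xi_i)]$ for every $i\ge 1$ and, for any $\epsilon>0$, $$\lim_{n\to\infty}C\Big(\Big|\frac1n\sum_{i=1}^n(\xi_i-\lambda_i)\Big|>\epsilon\Big)=0.$$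
   Context: A functional $\mathcal{E}:\mathcal{X}\to\mathbb{R}$ is a sublinear expectation if: (i) $\xi_1\ge\xi_2$ implies $\mathcal{E}(\xi_1)\ge\mathcal{E}(\xi_2)$; (ii) $\mathcal{E}(\lambda)=\lambda$ for every constant $\lambda\in\mathbb{R}$; (iii) $\mathcal{E}(\xi_1+\xi_2)\le\mathcal{E}(\xi_1)+\mathcal{E}(\xi_2)$ for all $\xi_1,\xi_2\in\mathcal{X}$; (iv) $\mathcal{E}(\lambda\xi)=\lambda\mathcal{E}(\xi)$ for all $\lambda\ge 0$, $\xi\in\mathcal{X}$. $\{E_\mu;\mu\in\mathcal{M}\}$ denotes the set of all linear expectations (linear functionals on $\mathcal{X}$) dominated by $\mathcal{E}$, i.e. $E_\mu[\xi]\le\mathcal{E}(\xi)$ for all $\xi\in\mathcal{X}$; each such functional is identified with a finitely additive set function $\mu$ on $\mathcal{F}$, $\mu(A)=E_\mu[I_A]$. $\xi,\eta\in\mathcal{X}$ are uncorrelated with respect to $\mathcal{E}$ if $E_\mu[\xi\eta]=E_\mu[\xi]E_\mu[\eta]$ for every $\mu\in\mathcal{M}$. A sequence is pairwise uncorrelated if $\xi_i$ and $\xi_j$ are uncorrelated for all $i\ne j$. The capacity $C$ is defined by $C(A):=\mathcal{E}(I_A)$ for $A\in\mathcal{F}$. *)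

theory Defs
  imports "HOL-Analysis.Analysis"
begin

text \<open>
  The measurable space is \<open>(space M, sets M)\<close> for \<open>M :: 'a measure\<close>; the measure
  carried by \<open>M\<close> is never used.  Elements of \<open>bounded_measurable M\<close> are total functions on
  the type \<open>'a\<close> standing for their restrictions to \<open>space M\<close>.  Accordingly, the order in
  the monotonicity axiom is pointwise on \<open>space M\<close>, which makes every sublinear expectation
  depend only on the values of its argument on \<open>space M\<close>.  Functionals on
  \<open>bounded_measurable M\<close> are total as well; their values elsewhere are irrelevant.
\<close>

definition bounded_measurable :: "'a measure \<Rightarrow> ('a \<Rightarrow> real) set" where
  "bounded_measurable M = {f \<in> borel_measurable M. bounded (f ` space M)}"

definition sublinear_expectation :: "'a measure \<Rightarrow> (('a \<Rightarrow> real) \<Rightarrow> real) \<Rightarrow> bool" where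
  "sublinear_expectation M E \<longleftrightarrow>
     (\<forall>f\<in>bounded_measurable M. \<forall>g\<in>bounded_measurable M.
        (\<forall>\<omega>\<in>space M. f \<omega> \<ge> g \<omega>) \<longrightarrow> E f \<ge> E g) \<and>
     (\<forall>c. E (\<lambda>\<omega>. c) = c) \<and>
     (\<forall>f\<in>bounded_measurable M. \<forall>g\<in>bounded_measurable M.
        E (\<lambda>\<omega>. f \<omega> + g \<omega>) \<le> E f + E g) \<and>
     (\<forall>c\<ge>0. \<forall>f\<in>bounded_measurable M. E (\<lambda>\<omega>. c * f \<omega>) = c * E f)"

text \<open>
  The family of the \<open>E\<^sub>\<mu>\<close>, indexed by the functionals themselves rather than by the
  finitely additive set functions \<open>\<mu>\<close> they are identified with.  Positivity and
  preservation of constants need not be required: for a sublinear expectation \<open>E\<close> they follow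
  from linearity and domination.
\<close>

definition dominated_linear_expectations ::
    "'a measure \<Rightarrow> (('a \<Rightarrow> real) \<Rightarrow> real) \<Rightarrow> (('a \<Rightarrow> real) \<Rightarrow> real) set" where
  "dominated_linear_expectations M E = {L.
     (\<forall>f\<in>bounded_measurable M. \<forall>g\<in>bounded_measurable M.
        L (\<lambda>\<omega>. f \<omega> + g \<omega>) = L f + L g) \<and>
     (\<forall>c. \<forall>f\<in>bounded_measurable M. L (\<lambda>\<omega>. c * f \<omega>) = c * L f) \<and>
     (\<forall>f\<in>bounded_measurable M. L f \<le> E f)}"

definition uncorrelated ::
    "'a measure \<Rightarrow> (('a \<Rightarrow> real) \<Rightarrow> real) \<Rightarrow> ('a \<Rightarrow> real) \<Rightarrow> ('a \<Rightarrow> real) \<Rightarrow> bool" where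
  "uncorrelated M E f g \<longleftrightarrow>
     (\<forall>L\<in>dominated_linear_expectations M E. L (\<lambda>\<omega>. f \<omega> * g \<omega>) = L f * L g)"

definition capacity :: "(('a \<Rightarrow> real) \<Rightarrow> real) \<Rightarrow> 'a set \<Rightarrow> real" where
  "capacity E A = E (indicat_real A)"

end

theory Submission
  imports Defs
begin

text \<open>
  The hypothesis is tested against all dominated linear expectations, and these form a convex
  set. Writing out uncorrelatedness of \<open>f\<close> and \<open>g\<close> for the midpoint of \<open>L\<close> and \<open>L'\<close>, and
  subtracting what it says for \<open>L\<close> and \<open>L'\<close> themselves, leaves
  \<open>(L f - L' f) * (L g - L' g) = 0\<close>: two dominated expectations cannot disagree on the means
  of both. This is rigid: since both upper means \<open>E f\<close> and \<open>E g\<close> are attained by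
  dominated expectations, no dominated \<open>L\<close> misses both of them
  (\<open>one_mean_is_maximal\<close>). Thus under each dominated \<open>L\<close> at most one variable of a pairwise
  uncorrelated sequence has a mean below its upper mean.

  Centring at \<open>l i = E (\<xi> i)\<close> therefore makes the variables orthogonal under every dominated
  \<open>L\<close>, and the expectation under \<open>L\<close> of the square of the \<open>n\<close>-th centred sum \<open>S\<close> is a sum of
  \<open>n\<close> bounded terms. Since some dominated \<open>L\<close> satisfies \<open>L (S\<^sup>2) = E (S\<^sup>2)\<close>, the growth of
  \<open>E (S\<^sup>2)\<close> is at most linear in \<open>n\<close>, and Chebyshev's inequality gives the weak law.

  That every value of \<open>E\<close> is attained by a dominated linear functional is the Hahn-Banach
  theorem (\<open>sublinear_on_attained\<close>). It is obtained here from Zorn's lemma applied to the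
  sublinear functionals below \<open>E\<close>: the minimal ones are linear.
\<close>

section \<open>Sublinear functionals and the Hahn-Banach theorem\<close>

definition function_space :: "('a \<Rightarrow> real) set \<Rightarrow> bool" where
  "function_space V \<longleftrightarrow> V \<noteq> {} \<and>
     (\<forall>f\<in>V. \<forall>g\<in>V. (\<lambda>x. f x + g x) \<in> V) \<and> (\<forall>c. \<forall>f\<in>V. (\<lambda>x. c * f x) \<in> V)"

text \<open>
  Homogeneity is imposed as an inequality because that is what passes directly to infima;
  replacing \<open>c\<close> by \<open>1 / c\<close> turns it into an equation (\<open>sublinear_on_scale\<close>).
\<close>

definition sublinear_on :: "('a \<Rightarrow> real) set \<Rightarrow> (('a \<Rightarrow> real) \<Rightarrow> real) \<Rightarrow> bool" where
  "sublinear_on V p \<longleftrightarrow>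
     (\<forall>f\<in>V. \<forall>g\<in>V. p (\<lambda>x. f x + g x) \<le> p f + p g) \<and>
     (\<forall>c\<ge>0. \<forall>f\<in>V. p (\<lambda>x. c * f x) \<le> c * p f)"

lemma function_space_add: "function_space V \<Longrightarrow> f \<in> V \<Longrightarrow> g \<in> V \<Longrightarrow> (\<lambda>x. f x + g x) \<in> V"
  and function_space_scale: "function_space V \<Longrightarrow> f \<in> V \<Longrightarrow> (\<lambda>x. c * f x) \<in> V"
  by (auto simp: function_space_def)

lemma function_space_uminus: "function_space V \<Longrightarrow> f \<in> V \<Longrightarrow> (\<lambda>x. - f x) \<in> V"
  using function_space_scale[of V f "-1"] by simp

lemma function_space_zero: "function_space V \<Longrightarrow> (\<lambda>x. 0) \<in> V"
  using function_space_scale[of V _ 0] by (auto simp: function_space_def)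

lemma function_space_sum:
  assumes "function_space V" "\<And>i. i \<in> I \<Longrightarrow> f i \<in> V"
  shows "(\<lambda>x. \<Sum>i\<in>I. f i x) \<in> V"
  using assms(2)
  by (induction I rule: infinite_finite_induct)
    (auto intro: function_space_zero function_space_add assms(1))

lemma sublinear_on_add:
    "sublinear_on V p \<Longrightarrow> f \<in> V \<Longrightarrow> g \<in> V \<Longrightarrow> p (\<lambda>x. f x + g x) \<le> p f + p g"
  and sublinear_on_scale_le:
    "sublinear_on V p \<Longrightarrow> c \<ge> 0 \<Longrightarrow> f \<in> V \<Longrightarrow> p (\<lambda>x. c * f x) \<le> c * p f"
  by (auto simp: sublinear_on_def)

lemma sublinear_on_zero:
  assumes "function_space V" "sublinear_on V p"
  shows "p (\<lambda>x. 0) = 0"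
  using sublinear_on_add[OF assms(2), of "\<lambda>x. 0" "\<lambda>x. 0"]
    sublinear_on_scale_le[OF assms(2), of 0 "\<lambda>x. 0"] function_space_zero[OF assms(1)]
  by simp

lemma sublinear_on_scale:
  assumes V: "function_space V" and p: "sublinear_on V p" and "c \<ge> 0" "f \<in> V"
  shows "p (\<lambda>x. c * f x) = c * p f"
proof (cases "c = 0")
  case True
  then show ?thesis using sublinear_on_zero[OF V p] by simp
next
  case False
  then have c: "c > 0" using assms by simp
  have "p f = p (\<lambda>x. 1 / c * (c * f x))" using c by simp
  also have "\<dots> \<le> 1 / c * p (\<lambda>x. c * f x)"
    using c by (intro sublinear_on_scale_le[OF p] function_space_scale V assms) auto
  finally have "c * p f \<le> p (\<lambda>x. c * f x)" using c by (simp add: field_simps)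
  then show ?thesis using sublinear_on_scale_le[OF p assms(3,4)] by simp
qed

lemma sublinear_on_uminus_lower:
  assumes V: "function_space V" and p: "sublinear_on V p" and "f \<in> V"
  shows "- p (\<lambda>x. - f x) \<le> p f"
  using sublinear_on_add[OF p \<open>f \<in> V\<close> function_space_uminus[OF V \<open>f \<in> V\<close>]]
    sublinear_on_zero[OF V p] by simp

text \<open>
  Lowering \<open>p\<close> in the direction \<open>g\<close>: the largest sublinear functional below \<open>p\<close> whose value
  at \<open>-g\<close> is at most \<open>-p g\<close>. It drives the whole construction. Applied to a minimal functional
  it shows linearity, and applied to \<open>E\<close> before minimising it fixes the value at \<open>g\<close>.
\<close>

definition lower_along :: "(('a \<Rightarrow> real) \<Rightarrow> real) \<Rightarrow> ('a \<Rightarrow> real) \<Rightarrow> ('a \<Rightarrow> real) \<Rightarrow> real" where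
  "lower_along p g f = (INF t\<in>{0..}. p (\<lambda>x. f x + t * g x) - t * p g)"

lemma lower_along_le:
  assumes V: "function_space V" and p: "sublinear_on V p" and "g \<in> V" "f \<in> V" "t \<ge> 0"
  shows "lower_along p g f \<le> p (\<lambda>x. f x + t * g x) - t * p g"
  unfolding lower_along_def
proof (rule cINF_lower)
  show "bdd_below ((\<lambda>t. p (\<lambda>x. f x + t * g x) - t * p g) ` {0..})"
  proof (rule bdd_belowI2)
    fix s :: real assume "s \<in> {0..}"
    then have s: "s \<ge> 0" by simp
    have "s * p g = p (\<lambda>x. (f x + s * g x) + - f x)"
      using sublinear_on_scale[OF V p s \<open>g \<in> V\<close>] by simp
    also have "\<dots> \<le> p (\<lambda>x. f x + s * g x) + p (\<lambda>x. - f x)"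
      using assms by (intro sublinear_on_add[OF p] function_space_add function_space_scale
        function_space_uminus V)
    finally show "- p (\<lambda>x. - f x) \<le> p (\<lambda>x. f x + s * g x) - s * p g" by simp
  qed
qed (use assms in auto)

lemma le_lower_along:
  assumes "\<And>t. t \<ge> 0 \<Longrightarrow> b \<le> p (\<lambda>x. f x + t * g x) - t * p g"
  shows "b \<le> lower_along p g f"
  unfolding lower_along_def by (rule cINF_greatest) (use assms in auto)

lemma lower_along_below:
  assumes "function_space V" "sublinear_on V p" "g \<in> V" "f \<in> V"
  shows "lower_along p g f \<le> p f"
  using lower_along_le[OF assms, of 0] by simp

lemma lower_along_uminus:
  assumes V: "function_space V" and p: "sublinear_on V p" and "g \<in> V"
  shows "lower_along p g (\<lambda>x. - g x) \<le> - p g"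
  using lower_along_le[OF V p \<open>g \<in> V\<close> function_space_uminus[OF V \<open>g \<in> V\<close>], of 1]
    sublinear_on_zero[OF V p] by simp

lemma sublinear_on_lower_along:
  assumes V: "function_space V" and p: "sublinear_on V p" and g: "g \<in> V"
  shows "sublinear_on V (lower_along p g)"
  unfolding sublinear_on_def
proof (intro conjI ballI allI impI)
  fix f h assume f: "f \<in> V" and h: "h \<in> V"
  let ?q = "lower_along p g"
  let ?fh = "\<lambda>x. f x + h x"
  have fh: "?fh \<in> V" using V f h by (rule function_space_add)
  (* Each infimum may use its own parameter; the sum of the two serves for the sum. *)
  have key: "?q ?fh \<le> (p (\<lambda>x. f x + s * g x) - s * p g) + (p (\<lambda>x. h x + t * g x) - t * p g)"
    if "s \<ge> 0" "t \<ge> 0" for s t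
  proof -
    have "?q ?fh \<le> p (\<lambda>x. ?fh x + (s + t) * g x) - (s + t) * p g"
      using that by (intro lower_along_le[OF V p g fh]) simp
    also have "(\<lambda>x. ?fh x + (s + t) * g x) = (\<lambda>x. (f x + s * g x) + (h x + t * g x))"
      by (simp add: algebra_simps)
    also have "p \<dots> \<le> p (\<lambda>x. f x + s * g x) + p (\<lambda>x. h x + t * g x)"
      by (intro sublinear_on_add[OF p] function_space_add function_space_scale V f g h)
    finally show ?thesis by (simp add: algebra_simps)
  qed
  have "?q ?fh - (p (\<lambda>x. f x + s * g x) - s * p g) \<le> ?q h" if "s \<ge> 0" for s
    by (rule le_lower_along) (use key[OF that] in \<open>fastforce simp: algebra_simps\<close>)
  then have "?q ?fh - ?q h \<le> ?q f"
    by (intro le_lower_along) (fastforce simp: algebra_simps)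
  then show "?q ?fh \<le> ?q f + ?q h" by simp
next
  fix c :: real and f assume c: "c \<ge> 0" and f: "f \<in> V"
  let ?q = "lower_along p g"
  show "?q (\<lambda>x. c * f x) \<le> c * ?q f"
  proof (cases "c = 0")
    case True
    then show ?thesis
      using lower_along_below[OF V p g function_space_zero[OF V]] sublinear_on_zero[OF V p]
      by simp
  next
    case False
    then have c: "c > 0" using c by simp
    have "?q (\<lambda>x. c * f x) / c \<le> ?q f"
    proof (rule le_lower_along)
      fix t :: real assume t: "t \<ge> 0"
      have "?q (\<lambda>x. c * f x) \<le> p (\<lambda>x. c * f x + (c * t) * g x) - (c * t) * p g"
        using c t by (intro lower_along_le[OF V p g] function_space_scale V f) simp
      also have "(\<lambda>x. c * f x + (c * t) * g x) = (\<lambda>x. c * (f x + t * g x))"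
        by (simp add: algebra_simps)
      also have "p \<dots> \<le> c * p (\<lambda>x. f x + t * g x)"
        using c by (intro sublinear_on_scale_le[OF p] function_space_add function_space_scale
          V f g) simp
      finally show "?q (\<lambda>x. c * f x) / c \<le> p (\<lambda>x. f x + t * g x) - t * p g"
        using c by (simp add: field_simps)
    qed
    then show ?thesis using c by (simp add: field_simps)
  qed
qed

text \<open>
  Subadditivity survives the infimum because, of two functionals in a chain, the smaller one
  serves both summands; the values stay bounded below by \<open>- E (-f)\<close>.
\<close>

lemma sublinear_on_INF_chain:
  assumes V: "function_space V" and ne: "C \<noteq> {}"
    and sub: "\<And>p. p \<in> C \<Longrightarrow> sublinear_on V p"
    and le: "\<And>p f. p \<in> C \<Longrightarrow> f \<in> V \<Longrightarrow> p f \<le> E f"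
    and chain: "\<And>p q. p \<in> C \<Longrightarrow> q \<in> C \<Longrightarrow> (\<forall>f\<in>V. p f \<le> q f) \<or> (\<forall>f\<in>V. q f \<le> p f)"
  shows "\<And>p f. p \<in> C \<Longrightarrow> f \<in> V \<Longrightarrow> (INF p\<in>C. p f) \<le> p f"
    and "sublinear_on V (\<lambda>f. INF p\<in>C. p f)"
proof -
  show low: "(INF p\<in>C. p f) \<le> p f" if "p \<in> C" "f \<in> V" for p f
  proof (rule cINF_lower[OF bdd_belowI2 that(1)])
    fix q assume "q \<in> C"
    then show "- E (\<lambda>x. - f x) \<le> q f"
      using sublinear_on_uminus_lower[OF V sub[OF \<open>q \<in> C\<close>] that(2)]
        le[OF \<open>q \<in> C\<close> function_space_uminus[OF V that(2)]] by simp
  qed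
  show "sublinear_on V (\<lambda>f. INF p\<in>C. p f)"
    unfolding sublinear_on_def
  proof (intro conjI ballI allI impI)
    fix f g assume f: "f \<in> V" and g: "g \<in> V"
    let ?fg = "\<lambda>x. f x + g x"
    have fg: "?fg \<in> V" using V f g by (rule function_space_add)
    have key: "(INF r\<in>C. r ?fg) \<le> p f + q g" if pq: "p \<in> C" "q \<in> C" for p q
    proof -
      obtain r where r: "r \<in> C" "r f \<le> p f" "r g \<le> q g"
        using chain[OF pq] pq f g by auto
      show ?thesis
        using low[OF r(1) fg] sublinear_on_add[OF sub[OF r(1)] f g] r by linarith
    qed
    have "(INF r\<in>C. r ?fg) - p f \<le> (INF q\<in>C. q g)" if "p \<in> C" for p
      using key[OF that] by (intro cINF_greatest ne) (auto simp: algebra_simps)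
    then have "(INF r\<in>C. r ?fg) - (INF q\<in>C. q g) \<le> (INF p\<in>C. p f)"
      by (intro cINF_greatest ne) (auto simp: algebra_simps)
    then show "(INF r\<in>C. r ?fg) \<le> (INF p\<in>C. p f) + (INF q\<in>C. q g)" by simp
  next
    fix c :: real and f assume c: "c \<ge> 0" and f: "f \<in> V"
    let ?cf = "\<lambda>x. c * f x"
    have cf: "?cf \<in> V" using V f by (rule function_space_scale)
    have key: "(INF r\<in>C. r ?cf) \<le> c * p f" if "p \<in> C" for p
      using low[OF that cf] sublinear_on_scale_le[OF sub[OF that] c f] by linarith
    show "(INF r\<in>C. r ?cf) \<le> c * (INF p\<in>C. p f)"
    proof (cases "c = 0")
      case True
      then show ?thesis using key ne by auto
    next
      case False
      then have "c > 0" using c by simp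
      then have "(INF r\<in>C. r ?cf) / c \<le> (INF p\<in>C. p f)"
        using key by (intro cINF_greatest ne) (auto simp: field_simps)
      then show ?thesis using \<open>c > 0\<close> by (simp add: field_simps)
    qed
  qed
qed

lemma exists_minimal_sublinear_on:
  assumes V: "function_space V" and E: "sublinear_on V E"
  obtains p where "sublinear_on V p" "\<And>f. f \<in> V \<Longrightarrow> p f \<le> E f"
    "\<And>q f. sublinear_on V q \<Longrightarrow> (\<And>f. f \<in> V \<Longrightarrow> q f \<le> p f) \<Longrightarrow> f \<in> V \<Longrightarrow> q f = p f"
proof -
  (* Values outside V are normalised to 0, so that comparison on V is antisymmetric. *)
  define restr :: "(('a \<Rightarrow> real) \<Rightarrow> real) \<Rightarrow> ('a \<Rightarrow> real) \<Rightarrow> real"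
    where "restr q = (\<lambda>f. if f \<in> V then q f else 0)" for q
  define A where "A = {p. sublinear_on V p \<and> (\<forall>f\<in>V. p f \<le> E f) \<and> restr p = p}"
  define R where "R = (\<lambda>p q :: ('a \<Rightarrow> real) \<Rightarrow> real. \<forall>f\<in>V. q f \<le> p f)"
  have restr_A: "restr q \<in> A" if "sublinear_on V q" "\<And>f. f \<in> V \<Longrightarrow> q f \<le> E f" for q
    using that function_space_add[OF V] function_space_scale[OF V]
    by (auto simp: A_def restr_def sublinear_on_def)
  have "\<exists>p\<in>A. \<forall>q\<in>A. R p q \<longrightarrow> q = p"
  proof (rule predicate_Zorn)
    have "p = q" if "p \<in> A" "q \<in> A" "R p q" "R q p" for p q
    proof -
      have "restr p = restr q" using that(3,4) by (fastforce simp: restr_def R_def)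
      then show ?thesis using that(1,2) by (simp add: A_def)
    qed
    moreover have "R p r" if "R p q" "R q r" for p q r
      using that by (fastforce simp: R_def)
    moreover have "R p p" for p by (simp add: R_def)
    ultimately show "partial_order_on A (relation_of R A)"
      by (intro partial_order_on_relation_ofI) blast+
  next
    fix C assume C: "C \<in> Chains (relation_of R A)"
    then have CA: "C \<subseteq> A" and cmp: "\<And>p q. p \<in> C \<Longrightarrow> q \<in> C \<Longrightarrow> R p q \<or> R q p"
      by (auto simp: Chains_def relation_of_def)
    show "\<exists>u\<in>A. \<forall>p\<in>C. R p u"
    proof (cases "C = {}")
      case True
      then show ?thesis using restr_A[OF E] by auto
    next
      case False
      let ?q = "\<lambda>f. INF p\<in>C. p f"
      have sub: "\<And>p. p \<in> C \<Longrightarrow> sublinear_on V p"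
        and le: "\<And>p f. p \<in> C \<Longrightarrow> f \<in> V \<Longrightarrow> p f \<le> E f"
        using CA by (auto simp: A_def)
      have chain: "(\<forall>f\<in>V. p f \<le> q f) \<or> (\<forall>f\<in>V. q f \<le> p f)" if "p \<in> C" "q \<in> C" for p q
        using cmp[OF that] by (auto simp: R_def)
      have q_le: "?q f \<le> p f" if "p \<in> C" "f \<in> V" for p f
        by (rule sublinear_on_INF_chain(1)[where E = E, OF V False]) (fact sub le chain that)+
      have q_sub: "sublinear_on V ?q"
        by (rule sublinear_on_INF_chain(2)[where E = E, OF V False]) (fact sub le chain)+
      obtain p0 where "p0 \<in> C" using False by blast
      then have "?q f \<le> E f" if "f \<in> V" for f
        using q_le[OF \<open>p0 \<in> C\<close> that] le[OF \<open>p0 \<in> C\<close> that] by linarith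
      then have "restr ?q \<in> A" by (intro restr_A q_sub)
      moreover have "R p (restr ?q)" if "p \<in> C" for p
        using q_le[OF that] by (auto simp: R_def restr_def)
      ultimately show ?thesis by blast
    qed
  qed
  then obtain p where p: "p \<in> A" and min: "\<And>q. q \<in> A \<Longrightarrow> R p q \<Longrightarrow> q = p" by blast
  show thesis
  proof
    show "sublinear_on V p" "\<And>f. f \<in> V \<Longrightarrow> p f \<le> E f" using p by (auto simp: A_def)
    fix q f assume q: "sublinear_on V q" "\<And>f. f \<in> V \<Longrightarrow> q f \<le> p f" and f: "f \<in> V"
    have "restr q \<in> A" using p q by (intro restr_A) (force simp: A_def)+
    then have "restr q = p" using q(2) by (intro min) (auto simp: R_def restr_def)
    then show "q f = p f" using f by (auto simp: restr_def)
  qed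
qed

text \<open>
  Lowering \<open>E\<close> along \<open>g\<close> forces every sublinear functional \<open>p\<close> below it to satisfy
  \<open>p (-g) \<le> - E g\<close>, hence \<open>p g \<ge> E g\<close>. A minimal such \<open>p\<close> cannot be lowered further along any
  \<open>f\<close>, so \<open>p (-f) = - p f\<close>, and a sublinear functional that is odd is linear.
\<close>

theorem sublinear_on_attained:
  assumes V: "function_space V" and E: "sublinear_on V E" and g: "g \<in> V"
  obtains L where "\<And>f h. f \<in> V \<Longrightarrow> h \<in> V \<Longrightarrow> L (\<lambda>x. f x + h x) = L f + L h"
    "\<And>c f. f \<in> V \<Longrightarrow> L (\<lambda>x. c * f x) = c * L f"
    "\<And>f. f \<in> V \<Longrightarrow> L f \<le> E f" "L g = E g"
proof -
  obtain p where p: "sublinear_on V p" and le: "\<And>f. f \<in> V \<Longrightarrow> p f \<le> lower_along E g f"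
    and min: "\<And>q f. sublinear_on V q \<Longrightarrow> (\<And>f. f \<in> V \<Longrightarrow> q f \<le> p f) \<Longrightarrow> f \<in> V \<Longrightarrow> q f = p f"
    using exists_minimal_sublinear_on[OF V sublinear_on_lower_along[OF V E g]] by blast
  have neg: "(\<lambda>x. - f x) \<in> V" if "f \<in> V" for f
    using V that by (rule function_space_uminus)
  have odd: "p (\<lambda>x. - f x) = - p f" if f: "f \<in> V" for f
  proof -
    have "p (\<lambda>x. - f x) = lower_along p f (\<lambda>x. - f x)"
      using min[OF sublinear_on_lower_along[OF V p f] lower_along_below[OF V p f] neg[OF f]]
      by simp
    also have "\<dots> \<le> - p f" using V p f by (rule lower_along_uminus)
    finally show ?thesis using sublinear_on_uminus_lower[OF V p f] by simp
  qed
  show thesis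
  proof
    show below: "p f \<le> E f" if "f \<in> V" for f
      using le[OF that] lower_along_below[OF V E g that] by linarith
    show "p g = E g"
      using le[OF neg[OF g]] lower_along_uminus[OF V E g] odd[OF g] below[OF g] by linarith
    show "p (\<lambda>x. f x + h x) = p f + p h" if f: "f \<in> V" and h: "h \<in> V" for f h
      using sublinear_on_add[OF p f h] sublinear_on_add[OF p neg[OF f] neg[OF h]]
        odd[OF function_space_add[OF V f h]] odd[OF f] odd[OF h] by simp
    show "p (\<lambda>x. c * f x) = c * p f" if f: "f \<in> V" for c f
    proof (cases "c \<ge> 0")
      case True
      then show ?thesis using V p f by (intro sublinear_on_scale) auto
    next
      case False
      then have "p (\<lambda>x. - c * f x) = - c * p f"
        using V p f by (intro sublinear_on_scale) auto
      then show ?thesis using odd[OF function_space_scale[OF V f, of c]] by simp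
    qed
  qed
qed

section \<open>Dominated linear expectations\<close>

lemma function_space_bounded_measurable: "function_space (bounded_measurable M)"
  unfolding function_space_def
proof (intro conjI ballI allI)
  show "bounded_measurable M \<noteq> {}"
    by (auto simp: bounded_measurable_def image_constant_conv intro!: exI[of _ "\<lambda>x. 0"])
next
  fix f g assume "f \<in> bounded_measurable M" "g \<in> bounded_measurable M"
  then show "(\<lambda>x. f x + g x) \<in> bounded_measurable M"
    by (auto simp: bounded_measurable_def intro: bounded_plus_comp)
next
  fix c :: real and f assume "f \<in> bounded_measurable M"
  then show "(\<lambda>x. c * f x) \<in> bounded_measurable M"
    using bounded_scaling[of "f ` space M" c]
    by (auto simp: bounded_measurable_def image_image)
qed

lemma bounded_measurable_const: "(\<lambda>x. c) \<in> bounded_measurable M"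
  by (auto simp: bounded_measurable_def image_constant_conv)

lemma bounded_measurable_mult:
  assumes "f \<in> bounded_measurable M" "g \<in> bounded_measurable M"
  shows "(\<lambda>x. f x * g x) \<in> bounded_measurable M"
proof -
  obtain a b where a: "\<forall>x\<in>space M. \<bar>f x\<bar> \<le> a" and b: "\<forall>x\<in>space M. \<bar>g x\<bar> \<le> b"
    using assms by (auto simp: bounded_measurable_def bounded_iff)
  have "\<bar>f x * g x\<bar> \<le> \<bar>a\<bar> * \<bar>b\<bar>" if "x \<in> space M" for x
    unfolding abs_mult using a b that by (intro mult_mono) fastforce+
  then show ?thesis using assms by (auto simp: bounded_measurable_def bounded_iff)
qed

lemma bounded_measurable_diff_const:
  "f \<in> bounded_measurable M \<Longrightarrow> (\<lambda>x. f x - c) \<in> bounded_measurable M"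
  using function_space_add[OF function_space_bounded_measurable _ bounded_measurable_const[of "-c"]]
  by simp

lemma bounded_measurable_indicator: "A \<in> sets M \<Longrightarrow> indicat_real A \<in> bounded_measurable M"
  by (auto simp: bounded_measurable_def bounded_iff intro!: exI[of _ 1])

lemma sublinear_expectation_mono:
  "\<lbrakk>sublinear_expectation M E; f \<in> bounded_measurable M; g \<in> bounded_measurable M;
    \<And>x. x \<in> space M \<Longrightarrow> f x \<le> g x\<rbrakk> \<Longrightarrow> E f \<le> E g"
  and sublinear_expectation_const: "sublinear_expectation M E \<Longrightarrow> E (\<lambda>x. c) = c"
  and sublinear_expectation_scale:
  "\<lbrakk>sublinear_expectation M E; f \<in> bounded_measurable M; a \<ge> 0\<rbrakk> \<Longrightarrow> E (\<lambda>x. a * f x) = a * E f"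
  by (auto simp: sublinear_expectation_def)

lemma sublinear_expectation_sublinear_on:
  "sublinear_expectation M E \<Longrightarrow> sublinear_on (bounded_measurable M) E"
  by (auto simp: sublinear_expectation_def sublinear_on_def)

lemma dominated_add:
  "\<lbrakk>L \<in> dominated_linear_expectations M E; f \<in> bounded_measurable M; g \<in> bounded_measurable M\<rbrakk>
    \<Longrightarrow> L (\<lambda>x. f x + g x) = L f + L g"
  and dominated_scale:
  "\<lbrakk>L \<in> dominated_linear_expectations M E; f \<in> bounded_measurable M\<rbrakk>
    \<Longrightarrow> L (\<lambda>x. c * f x) = c * L f"
  and dominated_le:
  "\<lbrakk>L \<in> dominated_linear_expectations M E; f \<in> bounded_measurable M\<rbrakk> \<Longrightarrow> L f \<le> E f"
  by (auto simp: dominated_linear_expectations_def)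

lemma dominated_attained:
  assumes "sublinear_expectation M E" "f \<in> bounded_measurable M"
  obtains L where "L \<in> dominated_linear_expectations M E" "L f = E f"
proof -
  obtain L where "L \<in> dominated_linear_expectations M E \<and> L f = E f"
    using sublinear_on_attained[OF function_space_bounded_measurable
        sublinear_expectation_sublinear_on[OF assms(1)] assms(2)]
    unfolding dominated_linear_expectations_def by (smt (verit) mem_Collect_eq)
  then show thesis using that by blast
qed

lemma dominated_const:
  assumes "sublinear_expectation M E" "L \<in> dominated_linear_expectations M E"
  shows "L (\<lambda>x. c) = c"
proof -
  note bc = bounded_measurable_const[of _ M]
  have "L (\<lambda>x. c) \<le> c" for c
    using dominated_le[OF assms(2) bc, of c] sublinear_expectation_const[OF assms(1), of c]
    by simp
  from this[of c] this[of "- c"] show ?thesis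
    using dominated_scale[OF assms(2) bc, of "-1" c] by simp
qed

lemma dominated_sum:
  assumes E: "sublinear_expectation M E" and L: "L \<in> dominated_linear_expectations M E"
    and "\<And>i. i \<in> I \<Longrightarrow> f i \<in> bounded_measurable M"
  shows "L (\<lambda>x. \<Sum>i\<in>I. f i x) = (\<Sum>i\<in>I. L (f i))"
  using assms(3)
  by (induction I rule: infinite_finite_induct)
    (auto simp: dominated_const[OF E L] dominated_add[OF L]
      function_space_sum[OF function_space_bounded_measurable])

lemma dominated_midpoint:
  assumes "L \<in> dominated_linear_expectations M E" "L' \<in> dominated_linear_expectations M E"
  shows "(\<lambda>f. (L f + L' f) / 2) \<in> dominated_linear_expectations M E"
proof -
  have "(L f + L' f) / 2 \<le> E f" if "f \<in> bounded_measurable M" for f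
    using dominated_le[OF assms(1) that] dominated_le[OF assms(2) that] by simp
  then show ?thesis
    using assms by (auto simp: dominated_linear_expectations_def field_simps)
qed

section \<open>Uncorrelated variables\<close>

lemma dominated_agree_on_one:
  assumes unc: "uncorrelated M E f g"
    and L: "L \<in> dominated_linear_expectations M E" and L': "L' \<in> dominated_linear_expectations M E"
  shows "L f = L' f \<or> L g = L' g"
proof -
  let ?fg = "\<lambda>x. f x * g x"
  have "L ?fg = L f * L g" "L' ?fg = L' f * L' g"
    using unc L L' by (auto simp: uncorrelated_def)
  moreover have "(L ?fg + L' ?fg) / 2 = (L f + L' f) / 2 * ((L g + L' g) / 2)"
    by (rule bspec[OF unc[unfolded uncorrelated_def] dominated_midpoint[OF L L']])
  ultimately have "(L f - L' f) * (L g - L' g) = 0" by (simp add: field_simps)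
  then show ?thesis by simp
qed

text \<open>
  If \<open>L\<close> missed both maxima, it would share its \<open>g\<close>-mean with an expectation attaining \<open>E f\<close>
  and its \<open>f\<close>-mean with one attaining \<open>E g\<close>; those two would then disagree on both means.
\<close>

lemma one_mean_is_maximal:
  assumes E: "sublinear_expectation M E" and unc: "uncorrelated M E f g"
    and f: "f \<in> bounded_measurable M" and g: "g \<in> bounded_measurable M"
    and L: "L \<in> dominated_linear_expectations M E"
  shows "L f = E f \<or> L g = E g"
proof -
  obtain P where P: "P \<in> dominated_linear_expectations M E" "P f = E f"
    using dominated_attained[OF E f] by blast
  obtain Q where Q: "Q \<in> dominated_linear_expectations M E" "Q g = E g"
    using dominated_attained[OF E g] by blast
  show ?thesis
    using dominated_agree_on_one[OF unc L P(1)] dominated_agree_on_one[OF unc L Q(1)]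
      dominated_agree_on_one[OF unc P(1) Q(1)] P(2) Q(2) by auto
qed

lemma centred_orthogonal:
  assumes E: "sublinear_expectation M E" and unc: "uncorrelated M E f g"
    and f: "f \<in> bounded_measurable M" and g: "g \<in> bounded_measurable M"
    and L: "L \<in> dominated_linear_expectations M E"
  shows "L (\<lambda>x. (f x - E f) * (g x - E g)) = 0"
proof -
  note V = function_space_bounded_measurable
  note mem = function_space_add[OF V] function_space_scale[OF V] bounded_measurable_const
    bounded_measurable_mult f g
  have "(\<lambda>x. (f x - E f) * (g x - E g))
      = (\<lambda>x. f x * g x + ((- E g) * f x + ((- E f) * g x + E f * E g)))"
    by (simp add: algebra_simps)
  moreover have "L (\<lambda>x. f x * g x + ((- E g) * f x + ((- E f) * g x + E f * E g)))
      = L (\<lambda>x. f x * g x) + ((- E g) * L f + ((- E f) * L g + E f * E g))"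
    by (simp only: dominated_add[OF L] dominated_scale[OF L] dominated_const[OF E L] mem)
  moreover have "L (\<lambda>x. f x * g x) = L f * L g"
    using unc L by (simp add: uncorrelated_def)
  ultimately have "L (\<lambda>x. (f x - E f) * (g x - E g)) = (L f - E f) * (L g - E g)"
    by (simp add: algebra_simps)
  then show ?thesis using one_mean_is_maximal[OF E unc f g L] by auto
qed

lemma sublinear_expectation_centred_sum_square_le:
  assumes E: "sublinear_expectation M E" and "finite I"
    and mem: "\<And>i. i \<in> I \<Longrightarrow> \<xi> i \<in> bounded_measurable M"
    and unc: "pairwise (\<lambda>i j. uncorrelated M E (\<xi> i) (\<xi> j)) I"
  shows "E (\<lambda>x. (\<Sum>i\<in>I. \<xi> i x - E (\<xi> i))\<^sup>2) \<le> (\<Sum>i\<in>I. E (\<lambda>x. (\<xi> i x - E (\<xi> i))\<^sup>2))"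
proof -
  note V = function_space_bounded_measurable
  let ?S = "\<lambda>x. (\<Sum>i\<in>I. \<xi> i x - E (\<xi> i))\<^sup>2"
  let ?c = "\<lambda>i x. \<xi> i x - E (\<xi> i)"
  have S: "?S = (\<lambda>x. \<Sum>i\<in>I. \<Sum>j\<in>I. ?c i x * ?c j x)"
    by (simp add: power2_eq_square sum_product)
  have c: "?c i \<in> bounded_measurable M" if "i \<in> I" for i
    using mem[OF that] by (rule bounded_measurable_diff_const)
  have cc: "(\<lambda>x. ?c i x * ?c j x) \<in> bounded_measurable M" if "i \<in> I" "j \<in> I" for i j
    by (rule bounded_measurable_mult[OF c[OF that(1)] c[OF that(2)]])
  have row: "(\<lambda>x. \<Sum>j\<in>I. ?c i x * ?c j x) \<in> bounded_measurable M" if "i \<in> I" for i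
    using cc that by (intro function_space_sum[OF V]) auto
  have "?S \<in> bounded_measurable M"
    unfolding S by (rule function_space_sum[OF V row])
  then obtain L where L: "L \<in> dominated_linear_expectations M E" and LS: "L ?S = E ?S"
    using dominated_attained[OF E] by blast
  have "E ?S = L (\<lambda>x. \<Sum>i\<in>I. \<Sum>j\<in>I. ?c i x * ?c j x)"
    using LS S by simp
  also have "\<dots> = (\<Sum>i\<in>I. \<Sum>j\<in>I. L (\<lambda>x. ?c i x * ?c j x))"
    by (simp add: dominated_sum[OF E L] row cc cong: sum.cong)
  also have "\<dots> = (\<Sum>i\<in>I. \<Sum>j\<in>I. if j = i then L (\<lambda>x. (?c i x)\<^sup>2) else 0)"
  proof (intro sum.cong refl)
    fix i j assume ij: "i \<in> I" "j \<in> I"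
    show "L (\<lambda>x. ?c i x * ?c j x) = (if j = i then L (\<lambda>x. (?c i x)\<^sup>2) else 0)"
    proof (cases "j = i")
      case True
      then show ?thesis by (simp add: power2_eq_square)
    next
      case False
      then have "uncorrelated M E (\<xi> i) (\<xi> j)"
        using unc ij by (auto simp: pairwise_def)
      then show ?thesis using centred_orthogonal[OF E _ _ _ L] mem ij False by simp
    qed
  qed
  also have "\<dots> = (\<Sum>i\<in>I. L (\<lambda>x. (?c i x)\<^sup>2))"
    using \<open>finite I\<close> by simp
  also have "\<dots> \<le> (\<Sum>i\<in>I. E (\<lambda>x. (?c i x)\<^sup>2))"
    using cc by (intro sum_mono dominated_le[OF L]) (simp add: power2_eq_square)
  finally show ?thesis .
qed

section \<open>The weak law of large numbers\<close>

lemma capacity_nonneg: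
  assumes "sublinear_expectation M E" "A \<in> sets M"
  shows "capacity E A \<ge> 0"
  using sublinear_expectation_mono[OF assms(1) bounded_measurable_const
      bounded_measurable_indicator[OF assms(2)], of 0]
    sublinear_expectation_const[OF assms(1), of 0]
  by (simp add: capacity_def)

lemma capacity_chebyshev:
  assumes E: "sublinear_expectation M E" and f: "f \<in> bounded_measurable M" and "\<epsilon> > 0"
  shows "capacity E {x \<in> space M. \<bar>f x\<bar> > \<epsilon>} \<le> E (\<lambda>x. (f x)\<^sup>2) / \<epsilon>\<^sup>2"
proof -
  let ?A = "{x \<in> space M. \<bar>f x\<bar> > \<epsilon>}"
  have [measurable]: "f \<in> borel_measurable M" using f by (simp add: bounded_measurable_def)
  have A: "?A \<in> sets M" by measurable
  have f2: "(\<lambda>x. (f x)\<^sup>2) \<in> bounded_measurable M"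
    using bounded_measurable_mult[OF f f] by (simp add: power2_eq_square)
  have "E (indicat_real ?A) \<le> E (\<lambda>x. 1 / \<epsilon>\<^sup>2 * (f x)\<^sup>2)"
  proof (rule sublinear_expectation_mono[OF E bounded_measurable_indicator[OF A]])
    show "(\<lambda>x. 1 / \<epsilon>\<^sup>2 * (f x)\<^sup>2) \<in> bounded_measurable M"
      by (rule function_space_scale[OF function_space_bounded_measurable f2])
    fix x assume x: "x \<in> space M"
    show "indicat_real ?A x \<le> 1 / \<epsilon>\<^sup>2 * (f x)\<^sup>2"
    proof (cases "x \<in> ?A")
      case True
      then have "\<epsilon>\<^sup>2 \<le> \<bar>f x\<bar>\<^sup>2" using \<open>\<epsilon> > 0\<close> by (intro power_mono) auto
      then show ?thesis using True \<open>\<epsilon> > 0\<close> by (simp add: field_simps)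
    qed simp
  qed
  also have "\<dots> = 1 / \<epsilon>\<^sup>2 * E (\<lambda>x. (f x)\<^sup>2)"
    by (rule sublinear_expectation_scale[OF E f2]) simp
  finally show ?thesis by (simp add: capacity_def)
qed

theorem theorem2p9:
  fixes M :: "'a measure"
    and E :: "('a \<Rightarrow> real) \<Rightarrow> real"
    and \<xi> :: "nat \<Rightarrow> 'a \<Rightarrow> real"
  assumes "sublinear_expectation M E"
    and "\<And>n. n \<ge> 1 \<Longrightarrow> \<xi> n \<in> bounded_measurable M"
    and "pairwise (\<lambda>i j. uncorrelated M E (\<xi> i) (\<xi> j)) {1..}"
    and "bdd_above ((\<lambda>n. E (\<lambda>\<omega>. (\<xi> n \<omega> - E (\<xi> n))\<^sup>2)
                        + (E (\<xi> n) + E (\<lambda>\<omega>. - \<xi> n \<omega>))\<^sup>2) ` {1..})"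
  shows "\<exists>l :: nat \<Rightarrow> real.
           (\<forall>i\<ge>1. l i \<in> {- E (\<lambda>\<omega>. - \<xi> i \<omega>) .. E (\<xi> i)}) \<and>
           (\<forall>\<epsilon>>0. (\<lambda>n. capacity E
              {\<omega> \<in> space M. \<bar>1 / real n * (\<Sum>i=1..n. (\<xi> i \<omega> - l i))\<bar> > \<epsilon>}) \<longlonglongrightarrow> 0)"
proof -
  note E = assms(1) and mem = assms(2) and V = function_space_bounded_measurable
  define X where "X n = (\<lambda>x. 1 / real n * (\<Sum>i=1..n. \<xi> i x - E (\<xi> i)))" for n
  obtain K where K: "\<And>n. n \<ge> 1 \<Longrightarrow> E (\<lambda>\<omega>. (\<xi> n \<omega> - E (\<xi> n))\<^sup>2) \<le> K"
  proof -
    obtain K where "\<And>n. n \<ge> 1 \<Longrightarrow> E (\<lambda>\<omega>. (\<xi> n \<omega> - E (\<xi> n))\<^sup>2)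
        + (E (\<xi> n) + E (\<lambda>\<omega>. - \<xi> n \<omega>))\<^sup>2 \<le> K"
      using assms(4) by (auto simp: bdd_above_def)
    then show thesis
      using that[of K] by (smt (verit) zero_le_power2)
  qed
  have sum_mem: "(\<lambda>x. \<Sum>i=1..n. \<xi> i x - E (\<xi> i)) \<in> bounded_measurable M" for n
    using mem by (intro function_space_sum[OF V] bounded_measurable_diff_const) simp
  then have X_mem: "X n \<in> bounded_measurable M" for n
    unfolding X_def by (rule function_space_scale[OF V])
  have X2: "E (\<lambda>x. (X n x)\<^sup>2) \<le> K / real n" if "n \<ge> 1" for n
  proof -
    let ?S = "\<lambda>x. \<Sum>i=1..n. \<xi> i x - E (\<xi> i)"
    have "E (\<lambda>x. (?S x)\<^sup>2) \<le> (\<Sum>i=1..n. E (\<lambda>x. (\<xi> i x - E (\<xi> i))\<^sup>2))"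
      using mem by (intro sublinear_expectation_centred_sum_square_le[OF E])
        (auto intro: pairwise_subset[OF assms(3)])
    also have "\<dots> \<le> (\<Sum>i=1..n. K)" using K by (intro sum_mono) simp
    finally have S2: "E (\<lambda>x. (?S x)\<^sup>2) \<le> real n * K" by simp
    have "E (\<lambda>x. (X n x)\<^sup>2) = E (\<lambda>x. (1 / real n)\<^sup>2 * (?S x)\<^sup>2)"
      unfolding X_def power_mult_distrib ..
    also have "\<dots> = (1 / real n)\<^sup>2 * E (\<lambda>x. (?S x)\<^sup>2)"
      using bounded_measurable_mult[OF sum_mem sum_mem]
      by (intro sublinear_expectation_scale[OF E]) (simp_all add: power2_eq_square)
    also have "\<dots> \<le> (1 / real n)\<^sup>2 * (real n * K)"
      by (intro mult_left_mono S2) simp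
    also have "\<dots> = K / real n" using that by (simp add: power2_eq_square)
    finally show ?thesis .
  qed
  have "(\<lambda>n. capacity E {\<omega> \<in> space M. \<bar>X n \<omega>\<bar> > \<epsilon>}) \<longlonglongrightarrow> 0" if "\<epsilon> > 0" for \<epsilon>
  proof (rule tendsto_sandwich)
    have "{\<omega> \<in> space M. \<bar>X n \<omega>\<bar> > \<epsilon>} \<in> sets M" for n
    proof -
      have [measurable]: "X n \<in> borel_measurable M"
        using X_mem[of n] by (simp add: bounded_measurable_def)
      show ?thesis by measurable
    qed
    then show "\<forall>\<^sub>F n in sequentially. 0 \<le> capacity E {\<omega> \<in> space M. \<bar>X n \<omega>\<bar> > \<epsilon>}"
      using capacity_nonneg[OF E] by simp
    show "\<forall>\<^sub>F n in sequentially. capacity E {\<omega> \<in> space M. \<bar>X n \<omega>\<bar> > \<epsilon>} \<le> K / real n / \<epsilon>\<^sup>2"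
      using eventually_ge_at_top[of 1]
    proof eventually_elim
      case (elim n)
      have "capacity E {\<omega> \<in> space M. \<bar>X n \<omega>\<bar> > \<epsilon>} \<le> E (\<lambda>x. (X n x)\<^sup>2) / \<epsilon>\<^sup>2"
        using capacity_chebyshev[OF E X_mem that] .
      also have "\<dots> \<le> K / real n / \<epsilon>\<^sup>2"
        using X2[OF elim] by (intro divide_right_mono) simp_all
      finally show ?case .
    qed
    have "(\<lambda>n. K / real n / \<epsilon>\<^sup>2) \<longlonglongrightarrow> 0 / \<epsilon>\<^sup>2"
      using that by (intro tendsto_divide lim_const_over_n tendsto_const) simp
    then show "(\<lambda>n. K / real n / \<epsilon>\<^sup>2) \<longlonglongrightarrow> 0" by simp
  qed simp
  then show ?thesis
    using sublinear_on_uminus_lower[OF V sublinear_expectation_sublinear_on[OF E] mem]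
    by (intro exI[of _ "\<lambda>i. E (\<xi> i)"]) (simp add: X_def)
qed

end
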